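(* Assume the standing assumptions (S), let $M^{(N)}:=\frac1{\sqrt N}\big(\alpha(\tfrac{|i-j|}{N})X^{(N)}_{ij}\big)_{1\le i,j\le N}$, and for $k\in\mathbb N$ set $Y^{(k)}_N:=\frac1N\operatorname{tr}(M^{(N)})^k$. Then $$\lim_{N\to\infty}\mathbb V\big(Y^{(k)}_N\big)=0\qquad\text{for all }k\in\mathbb N,$$ where $\mathbb V$ denotes the variance.
   Context: Standing assumptions (S): $\alpha:[0,1]\to\mathbb R$ is bounded and Riemann-integrable. For each $N\in\mathbb N$, $(X^{(N)}_{ij})_{1\le i,j\le N}$ are real random variables on a common probability space with $X^{(N)}_{ij}=X^{(N)}_{ji}$, $\mathbb E X^{(N)}_{ij}=0$, $\mathbb E (X^{(N)}_{ij})^2=1$, and $\sup_N\max_{i,j}\mathbb E|X^{(N)}_{ij}|^k\le R_k<\infty$ for every $k\ge 1$. For each $N$, $\sim$ is an equivalence relation on $\{1,\dots,N\}^2$ with $(p,q)\sim(q,p)$ for all $p,q$, satisfying, as $N\to\infty$: (C1) $\max_p\#\{(q,r,s)\in\{1,\dots,N\}^3:(p,q)\sim(r,s)\}=o(N^2)$; (C2) $\max_{p,q,r}\#\{s\in\{1,\dots,N\}:(p,q)\sim(r,s)\}\le B<\infty$ with $B$ independent of $N$; (C3) $\#\{(p,q,r)\in\{1,\dots,N\}^3:(p,q)\sim(q,r),\ r\neq p\}=o(N^2)$. Entries indexed by non-equivalent pairs are independent: for each $N$, the families $\{X^{(N)}_{pq}:(p,q)\in C\}$, $C$ ranging over the distinct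 $\sim$-equivalence classes, are mutually independent. *)

theory Defs
  imports "HOL-Probability.Probability" "Jordan_Normal_Form.Matrix"
begin

definition riemann_integrable_on :: "(real \<Rightarrow> real) \<Rightarrow> real \<Rightarrow> real \<Rightarrow> bool" where
  "riemann_integrable_on f a b \<longleftrightarrow>
     (\<exists>I. \<forall>\<epsilon>>0. \<exists>\<delta>>0. \<forall>(n::nat) (x::nat \<Rightarrow> real) (t::nat \<Rightarrow> real).
        n \<ge> 1 \<and> x 0 = a \<and> x n = b \<and>
        (\<forall>i\<in>{1..n}. x (i - 1) < x i \<and> x i - x (i - 1) < \<delta> \<and> x (i - 1) \<le> t i \<and> t i \<le> x i)
        \<longrightarrow> \<bar>(\<Sum>i=1..n. f (t i) * (x i - x (i - 1))) - I\<bar> < \<epsilon>)"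

text \<open>The matrix M^(N)(\<omega>), with entries (i,j) for 1 \<le> i,j \<le> N stored at 0-based
positions (i-1,j-1).\<close>
definition band_matrix :: "(real \<Rightarrow> real) \<Rightarrow> (nat \<Rightarrow> nat \<Rightarrow> nat \<Rightarrow> 'a \<Rightarrow> real) \<Rightarrow> nat \<Rightarrow> 'a \<Rightarrow> real mat" where
  "band_matrix \<alpha> X N \<omega> = mat N N (\<lambda>(i, j).
      \<alpha> (\<bar>real (i + 1) - real (j + 1)\<bar> / real N) * X N (i + 1) (j + 1) \<omega> / sqrt (real N))"

definition mat_trace :: "real mat \<Rightarrow> real" where
  "mat_trace A = (\<Sum>i<dim_row A. A $$ (i, i))"

definition Y_stat :: "(real \<Rightarrow> real) \<Rightarrow> (nat \<Rightarrow> nat \<Rightarrow> nat \<Rightarrow> 'a \<Rightarrow> real) \<Rightarrow> nat \<Rightarrow> nat \<Rightarrow> 'a \<Rightarrow> real" where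
  "Y_stat \<alpha> X k N \<omega> = mat_trace (band_matrix \<alpha> X N \<omega> ^\<^sub>m k) / real N"

end

theory Submission
  imports Defs
begin

text \<open>
  Expanding the trace, the variance is \<open>N\<^bsup>-k-2\<^esup>\<close> times a sum of covariances over pairs of closed
  walks of length \<open>k\<close>. Each covariance is bounded by the moment assumptions, and it vanishes unless
  the two walks share an edge class and every class occurs at least twice among the \<open>2k\<close> edges, so
  that at most \<open>k\<close> classes occur. It remains to see that there are only \<open>o(N\<^bsup>k+2\<^esup>)\<close> such pairs.
  Rotate both walks so that the shared class is that of their first edges. By (C1) there are
  \<open>N \<cdot> o(N\<^sup>2)\<close> choices for these two edges. Every further step either opens one of the at most \<open>k - 1\<close>
  remaining classes, with at most \<open>N\<close> choices of the next vertex, or uses a class already seen, which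
  by (C2) leaves a bounded number of choices.
\<close>

section \<open>Traces of matrix powers as sums over closed walks\<close>

lemma mat_pow_index_walks:
  fixes a :: "nat \<Rightarrow> nat \<Rightarrow> real"
  assumes "i < N" "j < N"
  shows "(mat N N (\<lambda>(i, j). a (Suc i) (Suc j)) ^\<^sub>m k) $$ (i, j) =
    (\<Sum>f | f \<in> {..k} \<rightarrow>\<^sub>E {1..N} \<and> f 0 = Suc i \<and> f k = Suc j. \<Prod>l<k. a (f l) (f (Suc l)))"
  using assms(2)
proof (induction k arbitrary: j)
  case 0
  have "{f. f \<in> {..0::nat} \<rightarrow>\<^sub>E {1..N} \<and> f 0 = Suc i \<and> f 0 = Suc j} =
    (if i = j then {\<lambda>x. if x = 0 then Suc i else undefined} else {})"
    using 0 assms(1) by (auto simp: PiE_iff extensional_def fun_eq_iff)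
  then show ?case using 0 assms by auto
next
  case (Suc k)
  let ?A = "mat N N (\<lambda>(i, j). a (Suc i) (Suc j))"
  let ?W = "\<lambda>k j. {f. f \<in> {..k} \<rightarrow>\<^sub>E {1..N} \<and> f 0 = Suc i \<and> f k = Suc j}"
  let ?w = "\<lambda>k f. \<Prod>l<k. a (f l) (f (Suc l))"
  have A: "?A ^\<^sub>m k \<in> carrier_mat N N" by (rule pow_carrier_mat) simp
  have fin: "finite (?W k l)" for l
    by (rule finite_subset[OF _ finite_PiE[of "{..k}" "\<lambda>_. {1..N}"]]) auto
  have dim: "dim_row (?A ^\<^sub>m k) = N" "dim_col (?A ^\<^sub>m k) = N" using A by auto
  have "(?A ^\<^sub>m Suc k) $$ (i, j) = (\<Sum>l<N. (?A ^\<^sub>m k) $$ (i, l) * a (Suc l) (Suc j))"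
    using dim assms(1) Suc.prems by (simp add: scalar_prod_def lessThan_atLeast0)
  also have "\<dots> = (\<Sum>l<N. \<Sum>f\<in>?W k l. ?w k f * a (f k) (Suc j))"
    by (intro sum.cong) (auto simp: Suc.IH sum_distrib_right)
  also have "\<dots> = (\<Sum>(l, f)\<in>(SIGMA l:{..<N}. ?W k l). ?w k f * a (f k) (Suc j))"
    using fin by (subst sum.Sigma) auto
  also have "\<dots> = (\<Sum>f\<in>?W (Suc k) j. ?w (Suc k) f)"
  \<comment> \<open>Cutting off the last vertex turns a walk of length \<open>Suc k\<close> into its
    penultimate vertex and a walk of length \<open>k\<close>. The \<open>- 1\<close> in the witness
    is the shift from vertices in \<open>{1..N}\<close> to matrix positions below
    \<open>N\<close>.\<close>
  proof (rule sum.reindex_bij_witness[where j = "\<lambda>(l, f). f(Suc k := Suc j)"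
        and i = "\<lambda>f. (f k - 1, restrict f {..k})"], goal_cases)
    case (1 x)
    then show ?case
      by (auto simp: fun_eq_iff restrict_def PiE_iff extensional_def)
  next
    case (2 x)
    then show ?case using Suc.prems
      by (auto simp: PiE_iff extensional_def)
  next
    case (3 f)
    then show ?case
      by (auto simp: fun_eq_iff restrict_def PiE_iff extensional_def) 
  next
    case (4 f)
    then have "f k \<in> {1..N}" using PiE_mem[of f "{..Suc k}" "\<lambda>_. {1..N}" k] by auto
    then obtain l where l: "f k = Suc l" "l < N" by (cases "f k") auto
    show ?case using 4 by (auto simp: PiE_iff l)
  next
    case (5 x)
    then show ?case by auto
  qed
  finally show ?case .
qed

text \<open>The start is stored twice, at \<open>0\<close> and at \<open>k\<close>, so that each
  edge is \<open>(f l, f (Suc l))\<close> without index arithmetic. Extensionality makes a walk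
  determined by its vertices, which finiteness and the injectivity arguments below rely on.\<close>

definition closed_walks :: "nat \<Rightarrow> 'v set \<Rightarrow> (nat \<Rightarrow> 'v) set" where
  "closed_walks k V = {f \<in> {..k} \<rightarrow>\<^sub>E V. f k = f 0}"

lemma finite_closed_walks: "finite V \<Longrightarrow> finite (closed_walks k V)"
  unfolding closed_walks_def by (simp add: finite_PiE)

lemma mat_trace_pow_closed_walks:
  "mat_trace (mat N N (\<lambda>(i, j). a (Suc i) (Suc j)) ^\<^sub>m k) =
    (\<Sum>f\<in>closed_walks k {1..N}. \<Prod>l<k. a (f l) (f (Suc l)))"
proof -
  let ?A = "mat N N (\<lambda>(i, j). a (Suc i) (Suc j))"
  let ?W = "\<lambda>i. {f. f \<in> {..k} \<rightarrow>\<^sub>E {1..N} \<and> f 0 = Suc i \<and> f k = Suc i}"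
  have A: "?A ^\<^sub>m k \<in> carrier_mat N N" by (rule pow_carrier_mat) simp
  have fin: "finite (?W l)" for l
    by (rule finite_subset[OF _ finite_PiE[of "{..k}" "\<lambda>_. {1..N}"]]) auto
  have "mat_trace (?A ^\<^sub>m k) = (\<Sum>i<N. \<Sum>f\<in>?W i. \<Prod>l<k. a (f l) (f (Suc l)))"
    using A by (auto simp: mat_trace_def mat_pow_index_walks intro!: sum.cong)
  also have "\<dots> = (\<Sum>f\<in>(\<Union>i<N. ?W i). \<Prod>l<k. a (f l) (f (Suc l)))"
    using fin by (subst sum.UNION_disjoint) auto
  \<comment> \<open>The diagonal entries sort the closed walks by their starting vertex.\<close>
  also have "(\<Union>i<N. ?W i) = closed_walks k {1..N}"
  proof (intro equalityI subsetI)
    fix f assume f: "f \<in> closed_walks k {1..N}"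
    then have "f 0 \<in> {1..N}" by (auto simp: closed_walks_def PiE_iff)
    then have "f \<in> ?W (f 0 - 1)" "f 0 - 1 \<in> {..<N}" using f by (auto simp: closed_walks_def)
    then show "f \<in> (\<Union>i<N. ?W i)" by blast
  qed (auto simp: closed_walks_def)
  finally show ?thesis .
qed

section \<open>Counting interleaved walks with a bounded number of edge classes\<close>

lemma card_Sigma_le:
  fixes b :: real
  assumes "finite A" "\<And>x. x \<in> A \<Longrightarrow> finite (B x)" "\<And>x. x \<in> A \<Longrightarrow> real (card (B x)) \<le> b"
  shows "real (card (SIGMA x:A. B x)) \<le> card A * b"
proof -
  have "real (card (SIGMA x:A. B x)) = (\<Sum>x\<in>A. real (card (B x)))"
    using assms by (simp add: card_SigmaI)
  also have "\<dots> \<le> card A * b" using assms(3) by (rule sum_bounded_above)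
  finally show ?thesis .
qed

text \<open>A function \<open>f\<close> on \<open>{..<m + 2}\<close> interleaves two walks \<open>f 0, f 2, \<dots>\<close> and \<open>f 1, f 3, \<dots>\<close>,
  so \<open>(f i, f (i + 2))\<close> is the \<open>i\<close>-th edge.\<close>
definition linked_walks ::
  "('v \<times> 'v) rel \<Rightarrow> 'v set \<Rightarrow> nat \<Rightarrow> nat \<Rightarrow> (nat \<Rightarrow> 'v) set" where
  "linked_walks R V m c = {f \<in> {..<m + 2} \<rightarrow>\<^sub>E V. ((f 0, f 2), (f 1, f 3)) \<in> R \<and>
     card ((\<lambda>i. R `` {(f i, f (i + 2))}) ` {..<m}) \<le> Suc c}"

lemma finite_linked_walks: "finite V \<Longrightarrow> finite (linked_walks R V m c)"
  unfolding linked_walks_def by (simp add: finite_PiE)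

text \<open>Base of the count: there are just four vertices, and once \<open>f 0\<close> is fixed,
  \<open>(f 2, f 1, f 3)\<close> is one of the triples that (C1) counts.\<close>

lemma card_linked_walks_2:
  fixes d :: real
  assumes "finite V"
    and C1: "\<And>p. p \<in> V \<Longrightarrow>
      real (card {(q, r, s). q \<in> V \<and> r \<in> V \<and> s \<in> V \<and> ((p, q), (r, s)) \<in> R}) \<le> d"
  shows "real (card (linked_walks R V 2 c)) \<le> card V * d"
proof -
  let ?T = "\<lambda>p. {(q, r, s). q \<in> V \<and> r \<in> V \<and> s \<in> V \<and> ((p, q), (r, s)) \<in> R}"
  let ?h = "\<lambda>f. (f 0, f 2, f 1, f (3::nat))"
  have fin: "finite (?T p)" for p
    by (rule finite_subset[of _ "V \<times> V \<times> V"]) (use assms(1) in auto)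
  have "inj_on ?h (linked_walks R V 2 c)"
  proof (rule inj_onI)
    fix f g assume fg: "f \<in> linked_walks R V 2 c" "g \<in> linked_walks R V 2 c" "?h f = ?h g"
    have "f x = g x" if "x \<in> {..<2+2}" for x
    proof -
      have "x = 0 \<or> x = 1 \<or> x = 2 \<or> x = 3" using that by auto
      then show ?thesis using fg(3) by auto
    qed
    then show "f = g"
      using fg(1,2) by (intro PiE_ext[of f "{..<2+2}" "\<lambda>_. V" g]) (auto simp: linked_walks_def)
  qed
  moreover have "?h ` linked_walks R V 2 c \<subseteq> (SIGMA p:V. ?T p)"
    by (auto simp: linked_walks_def PiE_iff)
  moreover have "finite (SIGMA p:V. ?T p)" using fin assms(1) by auto
  ultimately have "card (linked_walks R V 2 c) \<le> card (SIGMA p:V. ?T p)"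
    by (rule card_inj_on_le)
  then have "real (card (linked_walks R V 2 c)) \<le> real (card (SIGMA p:V. ?T p))" by simp
  also have "\<dots> \<le> card V * d" using assms fin by (intro card_Sigma_le)
  finally show ?thesis .
qed

text \<open>Delete the last vertex and look at the class of the edge
  \<open>(g m, g (m + 2))\<close>. If an earlier edge has this class, (C2) leaves at most
  \<open>B\<close> endpoints for each of the \<open>m\<close> earlier edges. Otherwise the endpoint
  is any vertex, but the shorter walk has one class fewer. Thus \<open>c\<close> is the budget of
  classes beyond the first.\<close>

lemma card_linked_walks_Suc:
  assumes "finite V" and R: "equiv (V \<times> V) R" and "m \<ge> 2"
    and C2: "\<And>p q r. p \<in> V \<Longrightarrow> q \<in> V \<Longrightarrow> r \<in> V \<Longrightarrow> card {s \<in> V. ((p, q), (r, s)) \<in> R} \<le> B"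
  shows "card (linked_walks R V (Suc m) c) \<le> m * B * card (linked_walks R V m c)
    + (if c = 0 then 0 else card V * card (linked_walks R V m (c - 1)))"
proof -
  define S where "S f = (\<Union>i<m. {s \<in> V. ((f i, f (i + 2)), (f m, s)) \<in> R})" for f
  let ?L = "linked_walks R V"
  let ?ext = "\<lambda>(f, s). f(m + 2 := s)"
  define P1 where "P1 = (SIGMA f:?L m c. S f)"
  define P2 where "P2 = (if c = 0 then {} else ?L m (c - 1) \<times> V)"
  have finS: "finite (S f)" for f using assms(1) by (auto simp: S_def)
  have fin: "finite P1" "finite P2"
    using finite_linked_walks[OF assms(1)] finS assms(1) by (auto simp: P1_def P2_def)
  have "?L (Suc m) c \<subseteq> ?ext ` (P1 \<union> P2)"
  proof
    fix g assume g: "g \<in> ?L (Suc m) c"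
    define f where "f = restrict g {..<m + 2}"
    let ?cl = "\<lambda>g i. R `` {(g i, g (i + 2))}"
    have gV: "g i \<in> V" if "i < m + 3" for i using g that by (auto simp: linked_walks_def PiE_iff)
    have fg: "f i = g i" if "i < m + 2" for i using that by (simp add: f_def)
    have ext: "g = f(m + 2 := g (m + 2))"
      using g by (auto simp: f_def linked_walks_def fun_eq_iff PiE_iff extensional_def)
    have cl: "?cl f ` {..<m} = ?cl g ` {..<m}" by (intro image_cong) (auto simp: fg)
    have gR: "((g 0, g 2), (g 1, g 3)) \<in> R" using g by (simp add: linked_walks_def)
    have fR: "((f 0, f 2), (f 1, f 3)) \<in> R" using gR \<open>m \<ge> 2\<close> by (simp add: fg)
    have fPi: "f \<in> {..<m + 2} \<rightarrow>\<^sub>E V" using gV by (auto simp: f_def)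
    have cardg: "card (insert (?cl g m) (?cl g ` {..<m})) \<le> Suc c"
      using g by (simp add: linked_walks_def lessThan_Suc)
    have edge: "(g i, g (i + 2)) \<in> V \<times> V" if "i \<le> m" for i using that by (auto intro!: gV)
    show "g \<in> ?ext ` (P1 \<union> P2)"
    proof (cases "?cl g m \<in> ?cl g ` {..<m}")
      case True
      then obtain i where i: "i < m" "?cl g i = ?cl g m" by auto
      then have "((g i, g (i + 2)), (g m, g (m + 2))) \<in> R"
        using eq_equiv_class[OF i(2) R] edge[of m] by simp
      then have "g (m + 2) \<in> S f" using i(1) gV[of "m + 2"] by (auto simp: S_def fg)
      moreover have "f \<in> ?L m c"
        using fPi fR cardg True cl by (simp add: linked_walks_def insert_absorb)
      ultimately have "(f, g (m + 2)) \<in> P1" by (simp add: P1_def)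
      then show ?thesis using ext by (intro image_eqI[of _ _ "(f, g (m + 2))"]) auto
    next
      case False
      then have le: "card (?cl g ` {..<m}) \<le> c" using cardg by simp
      \<comment> \<open>The earlier edges already use a class, so a new one forces
        \<open>c > 0\<close>. This is why the second summand vanishes for \<open>c = 0\<close>, and
        it keeps \<open>c - 1\<close> from being truncated.\<close>
      have "card (?cl g ` {..<m}) > 0" using \<open>m \<ge> 2\<close> by (auto simp: card_gt_0_iff lessThan_empty_iff)
      then have "c > 0" using le by simp
      then have "f \<in> ?L m (c - 1)" using fPi fR cl le by (simp add: linked_walks_def)
      then have "(f, g (m + 2)) \<in> P2" using \<open>c > 0\<close> gV[of "m + 2"] by (simp add: P2_def)
      then show ?thesis using ext by (intro image_eqI[of _ _ "(f, g (m + 2))"]) auto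
    qed
  qed
  then have "card (?L (Suc m) c) \<le> card (?ext ` (P1 \<union> P2))"
    using fin by (intro card_mono) auto
  also have "\<dots> \<le> card (P1 \<union> P2)" using fin by (intro card_image_le) auto
  also have "\<dots> \<le> card P1 + card P2" by (rule card_Un_le)
  also have "card P1 \<le> m * B * card (?L m c)"
  proof -
    have "card (S f) \<le> m * B" if f: "f \<in> ?L m c" for f
    proof -
      have fV: "f i \<in> V" if "i < m + 2" for i using f that by (auto simp: linked_walks_def PiE_iff)
      have "card (S f) \<le> (\<Sum>i<m. card {s \<in> V. ((f i, f (i + 2)), (f m, s)) \<in> R})"
        unfolding S_def by (rule card_UN_le) simp
      also have "\<dots> \<le> (\<Sum>i<m. B)" by (intro sum_mono C2 fV) auto
      finally show ?thesis by simp
    qed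
    then have "real (card P1) \<le> card (?L m c) * real (m * B)"
      unfolding P1_def using finS finite_linked_walks[OF assms(1)]
      by (intro card_Sigma_le) (auto simp del: of_nat_mult)
    then show ?thesis by (simp add: mult.commute flip: of_nat_mult)
  qed
  also have "card P2 = (if c = 0 then 0 else card V * card (?L m (c - 1)))"
    by (simp add: P2_def card_cartesian_product)
  finally show ?thesis by simp
qed

text \<open>Each step costs a factor \<open>n * B + 1\<close>: the first part pays for repeated
  classes, with \<open>m\<close> replaced by the uniform bound \<open>n\<close>, and the
  \<open>1\<close> pays for a new class, whose factor \<open>card V\<close> is absorbed by the power
  \<open>Suc c\<close>. The induction needs \<open>c\<close> arbitrary, since new classes lower
  it.\<close>

lemma card_linked_walks:
  fixes d :: real
  assumes V: "finite V" and R: "equiv (V \<times> V) R"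
    and C1: "\<And>p. p \<in> V \<Longrightarrow>
      real (card {(q, r, s). q \<in> V \<and> r \<in> V \<and> s \<in> V \<and> ((p, q), (r, s)) \<in> R}) \<le> d"
    and C2: "\<And>p q r. p \<in> V \<Longrightarrow> q \<in> V \<Longrightarrow> r \<in> V \<Longrightarrow> card {s \<in> V. ((p, q), (r, s)) \<in> R} \<le> B"
    and "2 \<le> m" "m \<le> n"
  shows "real (card (linked_walks R V m c)) \<le> real (n * B + 1) ^ (m - 2) * card V ^ Suc c * d"
  using assms(5,6)
proof (induction m arbitrary: c rule: dec_induct)
  case base
  show ?case
  \<comment> \<open>For empty \<open>V\<close> the bound (C1) is vacuous and says nothing about the
    sign of \<open>d\<close>, but both sides are zero.\<close>
  proof (cases "V = {}")
    case True
    then have "linked_walks R V 2 c = {}"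
      using PiE_mem[of _ "{..<4::nat}" "\<lambda>_. {}" 0] by (auto simp: linked_walks_def)
    then show ?thesis using True by simp
  next
    case False
    then obtain p where "p \<in> V" by auto
    then have "d \<ge> 0" using C1[of p] by (meson of_nat_0_le_iff order_trans)
    have "card V \<ge> 1" using False V by (simp add: Suc_le_eq card_gt_0_iff)
    then have "real (card V) \<le> card V ^ Suc c" by simp
    then have "card V * d \<le> card V ^ Suc c * d" using \<open>d \<ge> 0\<close> by (intro mult_right_mono) auto
    then show ?thesis using card_linked_walks_2[OF V C1, of c] by simp
  qed
next
  case (step m)
  let ?D = "real (n * B)"
  let ?b = "real (n * B + 1) ^ (m - 2)"
  have IH: "real (card (linked_walks R V m c)) \<le> ?b * card V ^ Suc c * d" for c
    using step.IH step.prems by simp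
  have "real (card (linked_walks R V (Suc m) c)) \<le> real (m * B * card (linked_walks R V m c)
    + (if c = 0 then 0 else card V * card (linked_walks R V m (c - 1))))"
    using card_linked_walks_Suc[OF V R \<open>2 \<le> m\<close> C2, of c] by (simp only: of_nat_le_iff)
  also have "\<dots> \<le> ?D * real (card (linked_walks R V m c))
    + (if c = 0 then 0 else card V * real (card (linked_walks R V m (c - 1))))"
    using step.prems by (auto intro!: mult_right_mono)
  also have "\<dots> \<le> ?D * (?b * card V ^ Suc c * d) + ?b * card V ^ Suc c * d"
  proof (intro add_mono mult_left_mono IH)
    show "(if c = 0 then 0 else card V * real (card (linked_walks R V m (c - 1)))) \<le> ?b * card V ^ Suc c * d"
    proof (cases "c = 0")
      case True
      \<comment> \<open>The summand is zero here, and the right-hand side is non-negative because it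
        bounds a cardinality.\<close>
      then show ?thesis using order_trans[OF of_nat_0_le_iff IH[of c]] by simp
    next
      case False
      then show ?thesis using mult_left_mono[OF IH[of "c - 1"], of "real (card V)"]
        by (cases c) (simp_all add: mult_ac)
    qed
  qed simp
  also have "\<dots> = real (n * B + 1) ^ Suc (m - 2) * card V ^ Suc c * d"
    by (simp add: algebra_simps)
  also have "Suc (m - 2) = Suc m - 2" using \<open>2 \<le> m\<close> by simp
  finally show ?case .
qed

section \<open>Pairs of closed walks sharing an edge class\<close>

definition edge_classes :: "('v \<times> 'v) rel \<Rightarrow> nat \<Rightarrow> (nat \<Rightarrow> 'v) \<Rightarrow> ('v \<times> 'v) set set" where
  "edge_classes R k f = (\<lambda>i. R `` {(f i, f (Suc i))}) ` {..<k}"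

text \<open>The two indices differ only at the wrap-around, where they are \<open>0\<close> and
  \<open>k\<close>, and a closed walk has the same vertex there. Hence edges of a rotated walk are
  edges of the original one.\<close>

lemma closed_walks_mod_Suc:
  assumes "f \<in> closed_walks k V"
  shows "f (Suc n mod k) = f (Suc (n mod k))"
  using assms by (auto simp: mod_Suc closed_walks_def)

lemma closed_walks_rotate_inject:
  assumes f: "f \<in> closed_walks k V" "f' \<in> closed_walks k V" and "a < k"
    and eq: "\<And>i. i < k \<Longrightarrow> f ((a + i) mod k) = f' ((a + i) mod k)"
  shows "f = f'"
proof -
  have lt: "f y = f' y" if "y < k" for y
  proof -
    \<comment> \<open>The offset \<open>y + k - a\<close> undoes the rotation; adding
      \<open>k\<close> first avoids truncated subtraction, as \<open>a < k\<close>.\<close>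
    have "(a + (y + k - a) mod k) mod k = (a + (y + k - a)) mod k" by (simp add: mod_simps)
    also have "\<dots> = y" using that \<open>a < k\<close> by simp
    finally show ?thesis using eq[of "(y + k - a) mod k"] \<open>a < k\<close> by simp
  qed
  moreover have "f k = f' k" using lt[of 0] \<open>a < k\<close> f by (simp add: closed_walks_def)
  ultimately have "f y = f' y" if "y \<in> {..k}" for y using that by (cases "y = k") auto
  then show ?thesis using f
    by (intro PiE_ext[of f "{..k}" "\<lambda>_. V" f']) (auto simp: closed_walks_def)
qed

text \<open>Rotating \<open>f\<close> by \<open>a\<close> and \<open>g\<close> by \<open>b\<close>
  makes the two related edges the first ones, and interleaving the results gives a linked walk with
  \<open>2 * k\<close> edges. Rotation preserves the edge classes, so the budget is
  \<open>k - 1\<close> classes beyond the first.\<close>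

lemma card_linked_closed_walks_at:
  assumes "finite V" "a < k" "b < k"
  shows "card {(f, g). f \<in> closed_walks k V \<and> g \<in> closed_walks k V \<and>
      ((f a, f (Suc a)), (g b, g (Suc b))) \<in> R \<and>
      card (edge_classes R k f \<union> edge_classes R k g) \<le> k}
    \<le> card (linked_walks R V (2 * k) (k - 1))" (is "card ?P \<le> card ?L")
proof -
  \<comment> \<open>Position \<open>j div 2\<close> of the rotated \<open>f\<close> or
    \<open>g\<close> goes to even or odd \<open>j\<close>. The last two entries, at
    \<open>2 * k\<close> and \<open>2 * k + 1\<close>, repeat the starting vertices and close the
    walks.\<close>
  define h where "h = (\<lambda>(f, g) j. if j < 2 * k + 2 then
      if even j then f ((a + j div 2) mod k) else g ((b + j div 2) mod k) else undefined :: 'a)"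
  have h_even: "h (f, g) (2 * i) = f ((a + i) mod k)" if "i < k" for f g i
    using that by (simp add: h_def)
  have h_odd: "h (f, g) (2 * i + 1) = g ((b + i) mod k)" if "i < k" for f g i
    using that by (simp add: h_def)
  have "inj_on h ?P"
  proof (rule inj_onI, clarify)
    fix f g f' g'
    assume W: "f \<in> closed_walks k V" "g \<in> closed_walks k V" "f' \<in> closed_walks k V" "g' \<in> closed_walks k V"
      and eq: "h (f, g) = h (f', g')"
    show "f = f' \<and> g = g'"
      using closed_walks_rotate_inject[OF W(1,3) assms(2)] closed_walks_rotate_inject[OF W(2,4) assms(3)]
        h_even h_odd eq by metis
  qed
  moreover have "h ` ?P \<subseteq> ?L"
  proof (clarify)
    fix f g
    assume W: "f \<in> closed_walks k V" "g \<in> closed_walks k V"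
      and R: "((f a, f (Suc a)), (g b, g (Suc b))) \<in> R"
      and c: "card (edge_classes R k f \<union> edge_classes R k g) \<le> k"
    have V: "f i \<in> V" "g i \<in> V" if "i \<le> k" for i
      using W that by (auto simp: closed_walks_def PiE_iff)
    have m: "x mod k < k" for x using assms by simp
    have "h (f, g) \<in> {..<2 * k + 2} \<rightarrow>\<^sub>E V"
      by (auto simp: h_def PiE_iff extensional_def intro!: V less_imp_le[OF m])
    moreover have "((h (f, g) 0, h (f, g) 2), (h (f, g) 1, h (f, g) 3)) \<in> R"
      using R assms closed_walks_mod_Suc[OF W(1), of a] closed_walks_mod_Suc[OF W(2), of b]
      by (simp add: h_def)
    moreover have "card ((\<lambda>i. R `` {(h (f, g) i, h (f, g) (i + 2))}) ` {..<2 * k}) \<le> Suc (k - 1)"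
    proof -
      have "R `` {(h (f, g) i, h (f, g) (i + 2))} \<in> edge_classes R k f \<union> edge_classes R k g"
        if "i < 2 * k" for i
      proof (cases "even i")
        case True
        then have "(h (f, g) i, h (f, g) (i + 2)) =
            (f ((a + i div 2) mod k), f (Suc ((a + i div 2) mod k)))"
          using that closed_walks_mod_Suc[OF W(1), of "a + i div 2"] by (simp add: h_def)
        then show ?thesis using m by (auto simp: edge_classes_def)
      next
        case False
        then have "(h (f, g) i, h (f, g) (i + 2)) =
            (g ((b + i div 2) mod k), g (Suc ((b + i div 2) mod k)))"
          using that closed_walks_mod_Suc[OF W(2), of "b + i div 2"] by (simp add: h_def)
        then show ?thesis using m by (auto simp: edge_classes_def)
      qed
      then have "card ((\<lambda>i. R `` {(h (f, g) i, h (f, g) (i + 2))}) ` {..<2 * k}) \<le>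
          card (edge_classes R k f \<union> edge_classes R k g)"
        by (intro card_mono) (auto simp: edge_classes_def)
      then show ?thesis using c assms by simp
    qed
    ultimately show "h (f, g) \<in> ?L" by (simp add: linked_walks_def)
  qed
  ultimately show ?thesis using finite_linked_walks[OF assms(1)] by (rule card_inj_on_le)
qed

text \<open>A shared class is attained at some pair of positions \<open>(a, b)\<close>, and summing
  over these costs the factor \<open>k\<close> squared.\<close>

lemma card_linked_closed_walks:
  fixes d :: real
  assumes V: "finite V" and R: "equiv (V \<times> V) R" and "k > 0"
    and C1: "\<And>p. p \<in> V \<Longrightarrow>
      real (card {(q, r, s). q \<in> V \<and> r \<in> V \<and> s \<in> V \<and> ((p, q), (r, s)) \<in> R}) \<le> d"
    and C2: "\<And>p q r. p \<in> V \<Longrightarrow> q \<in> V \<Longrightarrow> r \<in> V \<Longrightarrow> card {s \<in> V. ((p, q), (r, s)) \<in> R} \<le> B"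
  shows "real (card {(f, g). f \<in> closed_walks k V \<and> g \<in> closed_walks k V \<and>
      edge_classes R k f \<inter> edge_classes R k g \<noteq> {} \<and>
      card (edge_classes R k f \<union> edge_classes R k g) \<le> k})
    \<le> (real k)\<^sup>2 * real (2 * k * B + 1) ^ (2 * k - 2) * real (card V) ^ k * d" (is "real (card ?P) \<le> _")
proof -
  let ?Q = "\<lambda>(a, b). {(f, g). f \<in> closed_walks k V \<and> g \<in> closed_walks k V \<and>
      ((f a, f (Suc a)), (g b, g (Suc b))) \<in> R \<and>
      card (edge_classes R k f \<union> edge_classes R k g) \<le> k}"
  have fin: "finite (?Q ab)" for ab
    by (rule finite_subset[of _ "closed_walks k V \<times> closed_walks k V"])
      (use finite_closed_walks[OF V] in auto)
  have "?P \<subseteq> (\<Union>ab\<in>{..<k} \<times> {..<k}. ?Q ab)"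
  proof clarify
    fix f g
    assume W: "f \<in> closed_walks k V" "g \<in> closed_walks k V"
      and ne: "edge_classes R k f \<inter> edge_classes R k g \<noteq> {}"
      and c: "card (edge_classes R k f \<union> edge_classes R k g) \<le> k"
    obtain a b where ab: "a < k" "b < k" "R `` {(f a, f (Suc a))} = R `` {(g b, g (Suc b))}"
      using ne by (auto simp: edge_classes_def)
    have "(g b, g (Suc b)) \<in> V \<times> V" using W ab by (auto simp: closed_walks_def PiE_iff)
    then have "((f a, f (Suc a)), (g b, g (Suc b))) \<in> R" by (rule eq_equiv_class[OF ab(3) R])
    then show "(f, g) \<in> (\<Union>ab\<in>{..<k} \<times> {..<k}. ?Q ab)" using W c ab by auto
  qed
  then have "card ?P \<le> card (\<Union>ab\<in>{..<k} \<times> {..<k}. ?Q ab)"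
    using fin by (intro card_mono) auto
  also have "\<dots> \<le> (\<Sum>ab\<in>{..<k} \<times> {..<k}. card (?Q ab))" by (rule card_UN_le) simp
  also have "\<dots> \<le> (\<Sum>ab\<in>{..<k} \<times> {..<k}. card (linked_walks R V (2 * k) (k - 1)))"
    using card_linked_closed_walks_at[OF V] by (intro sum_mono) auto
  also have "\<dots> = k\<^sup>2 * card (linked_walks R V (2 * k) (k - 1))"
    by (simp add: power2_eq_square)
  finally have "real (card ?P) \<le> real (k\<^sup>2 * card (linked_walks R V (2 * k) (k - 1)))"
    by (simp only: of_nat_le_iff)
  also have "\<dots> = real (k\<^sup>2) * real (card (linked_walks R V (2 * k) (k - 1)))" by simp
  also have "\<dots> \<le> real (k\<^sup>2) * (real (2 * k * B + 1) ^ (2 * k - 2) * card V ^ Suc (k - 1) * d)"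
    using \<open>k > 0\<close> by (intro mult_left_mono card_linked_walks[OF V R C1 C2]) auto
  finally show ?thesis using \<open>k > 0\<close> by (simp add: mult_ac)
qed

section \<open>Moments and covariances of products with independent classes\<close>

lemma card_image_le_half:
  assumes "finite K" "\<And>i. i \<in> K \<Longrightarrow> \<exists>j\<in>K. j \<noteq> i \<and> \<phi> j = \<phi> i"
  shows "2 * card (\<phi> ` K) \<le> card K"
proof -
  have "2 \<le> card {i \<in> K. \<phi> i = y}" if "y \<in> \<phi> ` K" for y
  proof -
    from that obtain i where i: "i \<in> K" "\<phi> i = y" by auto
    obtain j where j: "j \<in> K" "j \<noteq> i" "\<phi> j = y" using assms(2)[OF i(1)] i(2) by auto
    have "card {i, j} \<le> card {i \<in> K. \<phi> i = y}"
      using assms(1) i j by (intro card_mono) auto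
    then show ?thesis using j(2) by simp
  qed
  then have "(\<Sum>y\<in>\<phi> ` K. 2) \<le> (\<Sum>y\<in>\<phi> ` K. card {i \<in> K. \<phi> i = y})" by (rule sum_mono)
  also have "\<dots> = card K"
    using sum.image_gen[OF assms(1), of "\<lambda>_. 1::nat" \<phi>] by simp
  finally show ?thesis by simp
qed

text \<open>The product is at most the power of its largest factor, and that power is one of the
  summands. This reduces mixed moments to absolute moments of single variables.\<close>

lemma abs_prod_le_sum_power:
  fixes x :: "'i \<Rightarrow> real"
  assumes "finite I" "I \<noteq> {}"
  shows "\<bar>\<Prod>i\<in>I. x i\<bar> \<le> (\<Sum>i\<in>I. \<bar>x i\<bar> ^ card I)"
proof -
  define m where "m = Max ((\<lambda>i. \<bar>x i\<bar>) ` I)"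
  have "m \<in> (\<lambda>i. \<bar>x i\<bar>) ` I" unfolding m_def using assms by (intro Max_in) auto
  then obtain j where j: "j \<in> I" "m = \<bar>x j\<bar>" by auto
  have "\<bar>\<Prod>i\<in>I. x i\<bar> = (\<Prod>i\<in>I. \<bar>x i\<bar>)" by (rule abs_prod)
  also have "\<dots> \<le> (\<Prod>i\<in>I. m)" using assms by (intro prod_mono) (auto simp: m_def)
  also have "\<dots> = \<bar>x j\<bar> ^ card I" using j by simp
  also have "\<dots> \<le> (\<Sum>i\<in>I. \<bar>x i\<bar> ^ card I)" using j assms by (intro member_le_sum) auto
  finally show ?thesis .
qed

text \<open>The probabilistic setting for one fixed \<open>N\<close>, with an abstract index set.
  Independence is that of the whole vectors belonging to the classes; inside a class any dependence
  is allowed.\<close>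

locale class_indep_family = prob_space +
  fixes E :: "'e set" and R :: "'e rel" and X :: "'e \<Rightarrow> 'a \<Rightarrow> real" and mom :: "nat \<Rightarrow> real"
  assumes finite_E: "finite E" and equiv_R: "equiv E R"
    and measurable_X: "e \<in> E \<Longrightarrow> X e \<in> borel_measurable M"
    and mean_X: "e \<in> E \<Longrightarrow> expectation (X e) = 0"
    and integrable_abs_power: "e \<in> E \<Longrightarrow> n \<ge> 1 \<Longrightarrow> integrable M (\<lambda>\<omega>. \<bar>X e \<omega>\<bar> ^ n)"
    and moment_X: "e \<in> E \<Longrightarrow> n \<ge> 1 \<Longrightarrow> expectation (\<lambda>\<omega>. \<bar>X e \<omega>\<bar> ^ n) \<le> mom n"
    and indep_classes: "indep_vars (\<lambda>C. PiM C (\<lambda>_. borel)) (\<lambda>C \<omega>. \<lambda>e\<in>C. X e \<omega>) (E // R)"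
begin

lemma integrable_prod_X:
  assumes "finite I" "ed ` I \<subseteq> E"
  shows "integrable M (\<lambda>\<omega>. \<Prod>i\<in>I. X (ed i) \<omega>)"
proof (cases "I = {}")
  case False
  then have c: "card I \<ge> 1" using assms by (simp add: Suc_le_eq card_gt_0_iff)
  show ?thesis
  proof (rule Bochner_Integration.integrable_bound)
    show "integrable M (\<lambda>\<omega>. \<Sum>i\<in>I. \<bar>X (ed i) \<omega>\<bar> ^ card I)"
      using assms c by (intro Bochner_Integration.integrable_sum integrable_abs_power) auto
    show "(\<lambda>\<omega>. \<Prod>i\<in>I. X (ed i) \<omega>) \<in> borel_measurable M"
      using assms by (intro borel_measurable_prod measurable_X) auto
    show "AE \<omega> in M. norm (\<Prod>i\<in>I. X (ed i) \<omega>) \<le> norm (\<Sum>i\<in>I. \<bar>X (ed i) \<omega>\<bar> ^ card I)"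
      using abs_prod_le_sum_power[OF assms(1) False]
      by (intro AE_I2) (force intro: order_trans)
  qed
qed simp

lemma abs_expectation_prod_X_le:
  assumes "finite I" "I \<noteq> {}" "ed ` I \<subseteq> E"
  shows "\<bar>expectation (\<lambda>\<omega>. \<Prod>i\<in>I. X (ed i) \<omega>)\<bar> \<le> card I * mom (card I)"
proof -
  have c: "card I \<ge> 1" using assms by (simp add: Suc_le_eq card_gt_0_iff)
  have int: "integrable M (\<lambda>\<omega>. \<bar>X (ed i) \<omega>\<bar> ^ card I)" if "i \<in> I" for i
    using assms c that by (intro integrable_abs_power) auto
  have "\<bar>expectation (\<lambda>\<omega>. \<Prod>i\<in>I. X (ed i) \<omega>)\<bar> \<le> expectation (\<lambda>\<omega>. \<bar>\<Prod>i\<in>I. X (ed i) \<omega>\<bar>)"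
    by (rule integral_abs_bound)
  also have "\<dots> \<le> expectation (\<lambda>\<omega>. \<Sum>i\<in>I. \<bar>X (ed i) \<omega>\<bar> ^ card I)"
    using integrable_prod_X[OF assms(1,3)] int abs_prod_le_sum_power[OF assms(1,2)]
    by (intro integral_mono) auto
  also have "\<dots> = (\<Sum>i\<in>I. expectation (\<lambda>\<omega>. \<bar>X (ed i) \<omega>\<bar> ^ card I))"
    using int by (intro Bochner_Integration.integral_sum) auto
  also have "\<dots> \<le> card I * mom (card I)"
    using assms c by (intro sum_bounded_above moment_X) auto
  finally show ?thesis .
qed

text \<open>Grouping the factors by class gives functions of independent vectors, so the expectation
  factorises. A class without factors contributes an empty product, with expectation 1.\<close>

lemma expectation_prod_X_classes:
  assumes "finite I" "ed ` I \<subseteq> E"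
  shows "expectation (\<lambda>\<omega>. \<Prod>i\<in>I. X (ed i) \<omega>) =
    (\<Prod>C\<in>E // R. expectation (\<lambda>\<omega>. \<Prod>i | i \<in> I \<and> R `` {ed i} = C. X (ed i) \<omega>))"
proof -
  let ?I = "\<lambda>C. {i. i \<in> I \<and> R `` {ed i} = C}"
  let ?P = "\<lambda>C \<omega>. \<Prod>i\<in>?I C. X (ed i) \<omega>"
  have mem: "ed i \<in> C" if "i \<in> ?I C" for i C
    using that assms(2) equiv_class_self[OF equiv_R] by auto
  have fin: "finite (E // R)" using finite_E equiv_R by (auto simp: finite_quotient equiv_type)
  \<comment> \<open>Each group is first written through the restricted class vector, to match
    \<open>indep_classes\<close>; the restriction then disappears since \<open>ed i\<close> lies in
    \<open>C\<close>.\<close>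
  have "indep_vars (\<lambda>_. borel) (\<lambda>C \<omega>. \<Prod>i\<in>?I C. (\<lambda>e\<in>C. X e \<omega>) (ed i)) (E // R)"
    by (rule indep_vars_compose2[OF indep_classes])
      (use mem in \<open>intro borel_measurable_prod measurable_component_singleton\<close>)
  also have "?this \<longleftrightarrow> indep_vars (\<lambda>_. borel) ?P (E // R)"
    by (intro indep_vars_cong refl ext prod.cong restrict_apply' mem)
  finally have ind: "indep_vars (\<lambda>_. borel) ?P (E // R)" .
  have "(\<Prod>i\<in>I. X (ed i) \<omega>) = (\<Prod>C\<in>E // R. ?P C \<omega>)" for \<omega>
    using assms fin by (subst prod.group) (auto intro!: quotientI)
  then show ?thesis
    using indep_vars_lebesgue_integral[OF fin ind] assms
    by (simp add: integrable_prod_X subset_eq)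
qed

text \<open>The class of \<open>ed i\<close> contributes the single factor \<open>X (ed i)\<close>,
  which is centred.\<close>

lemma expectation_prod_X_isolated:
  assumes "finite I" "ed ` I \<subseteq> E" "i \<in> I" "\<And>j. j \<in> I \<Longrightarrow> R `` {ed j} = R `` {ed i} \<Longrightarrow> j = i"
  shows "expectation (\<lambda>\<omega>. \<Prod>i\<in>I. X (ed i) \<omega>) = 0"
proof -
  have "{j. j \<in> I \<and> R `` {ed j} = R `` {ed i}} = {i}" using assms by auto
  moreover have "ed i \<in> E" using assms by auto
  moreover have "finite (E // R)" using finite_E equiv_R by (auto simp: finite_quotient equiv_type)
  ultimately show ?thesis
    unfolding expectation_prod_X_classes[OF assms(1,2)]
    by (intro prod_zero bexI[of _ "R `` {ed i}"]) (auto simp: mean_X intro: quotientI)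
qed

text \<open>Every class meets at most one of the two index sets, so for each class one of the two
  group expectations is 1.\<close>

lemma expectation_prod_X_Un:
  assumes "finite I" "finite J" "ed ` I \<subseteq> E" "ed ` J \<subseteq> E" "I \<inter> J = {}"
    and disj: "\<And>i j. i \<in> I \<Longrightarrow> j \<in> J \<Longrightarrow> R `` {ed i} \<noteq> R `` {ed j}"
  shows "expectation (\<lambda>\<omega>. \<Prod>i\<in>I \<union> J. X (ed i) \<omega>) =
    expectation (\<lambda>\<omega>. \<Prod>i\<in>I. X (ed i) \<omega>) * expectation (\<lambda>\<omega>. \<Prod>i\<in>J. X (ed i) \<omega>)"
proof -
  let ?e = "\<lambda>I C. expectation (\<lambda>\<omega>. \<Prod>i | i \<in> I \<and> R `` {ed i} = C. X (ed i) \<omega>)"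
  have "?e (I \<union> J) C = ?e I C * ?e J C" for C
  proof (cases "\<exists>i\<in>I. R `` {ed i} = C")
    case True
    then have "\<not> (i \<in> J \<and> R `` {ed i} = C)" for i using disj by metis
    then have "{i. i \<in> I \<union> J \<and> R `` {ed i} = C} = {i. i \<in> I \<and> R `` {ed i} = C}"
      "{i. i \<in> J \<and> R `` {ed i} = C} = {}" by auto
    then show ?thesis by (simp only: prod.empty) (simp add: prob_space)
  next
    case False
    then have "{i. i \<in> I \<union> J \<and> R `` {ed i} = C} = {i. i \<in> J \<and> R `` {ed i} = C}"
      "{i. i \<in> I \<and> R `` {ed i} = C} = {}" by auto
    then show ?thesis by (simp only: prod.empty) (simp add: prob_space)
  qed
  then show ?thesis
    using assms by (simp add: expectation_prod_X_classes image_Un prod.distrib)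
qed

text \<open>Without a common class the products are uncorrelated by independence. With too many
  classes, some class occurs exactly once, which kills the joint expectation and that of the product
  containing the isolated factor.\<close>

lemma covariance_prod_X_eq_0:
  assumes IJ: "finite I" "finite J" "ed ` I \<subseteq> E" "ed ` J \<subseteq> E" "I \<inter> J = {}"
    and neg: "(\<lambda>i. R `` {ed i}) ` I \<inter> (\<lambda>i. R `` {ed i}) ` J = {} \<or>
      card I + card J < 2 * card ((\<lambda>i. R `` {ed i}) ` I \<union> (\<lambda>i. R `` {ed i}) ` J)"
  shows "expectation (\<lambda>\<omega>. (\<Prod>i\<in>I. X (ed i) \<omega>) * (\<Prod>i\<in>J. X (ed i) \<omega>)) =
    expectation (\<lambda>\<omega>. \<Prod>i\<in>I. X (ed i) \<omega>) * expectation (\<lambda>\<omega>. \<Prod>i\<in>J. X (ed i) \<omega>)"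
proof -
  have un: "(\<Prod>i\<in>I. X (ed i) \<omega>) * (\<Prod>i\<in>J. X (ed i) \<omega>) = (\<Prod>i\<in>I \<union> J. X (ed i) \<omega>)" for \<omega>
    using IJ by (simp add: prod.union_disjoint)
  show ?thesis
  proof (cases "(\<lambda>i. R `` {ed i}) ` I \<inter> (\<lambda>i. R `` {ed i}) ` J = {}")
    case True
    then show ?thesis unfolding un using IJ by (intro expectation_prod_X_Un) auto
  next
    case False
    then have "card (I \<union> J) < 2 * card ((\<lambda>i. R `` {ed i}) ` (I \<union> J))"
      using neg IJ by (simp add: card_Un_disjoint image_Un)
    then obtain i where i: "i \<in> I \<union> J" "\<And>j. j \<in> I \<union> J \<Longrightarrow> R `` {ed j} = R `` {ed i} \<Longrightarrow> j = i"
      using card_image_le_half[of "I \<union> J" "\<lambda>i. R `` {ed i}"] IJ by (metis finite_UnI leD)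
    have "expectation (\<lambda>\<omega>. \<Prod>i\<in>I \<union> J. X (ed i) \<omega>) = 0"
      using i IJ by (intro expectation_prod_X_isolated[of _ _ i]) auto
    moreover have "expectation (\<lambda>\<omega>. \<Prod>i\<in>I. X (ed i) \<omega>) = 0 \<or> expectation (\<lambda>\<omega>. \<Prod>i\<in>J. X (ed i) \<omega>) = 0"
      using i IJ expectation_prod_X_isolated[of I ed i] expectation_prod_X_isolated[of J ed i] by auto
    ultimately show ?thesis unfolding un by auto
  qed
qed

lemma abs_covariance_prod_X_le:
  assumes IJ: "finite I" "finite J" "ed ` I \<subseteq> E" "ed ` J \<subseteq> E" "I \<inter> J = {}"
    and k: "card I = k" "card J = k" "k > 0"
  shows "\<bar>expectation (\<lambda>\<omega>. (\<Prod>i\<in>I. X (ed i) \<omega>) * (\<Prod>i\<in>J. X (ed i) \<omega>)) -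
    expectation (\<lambda>\<omega>. \<Prod>i\<in>I. X (ed i) \<omega>) * expectation (\<lambda>\<omega>. \<Prod>i\<in>J. X (ed i) \<omega>)\<bar>
    \<le> 2 * real k * mom (2 * k) + (real k * mom k)\<^sup>2"
proof -
  have ne: "I \<noteq> {}" "J \<noteq> {}" using k by auto
  have un: "(\<Prod>i\<in>I. X (ed i) \<omega>) * (\<Prod>i\<in>J. X (ed i) \<omega>) = (\<Prod>i\<in>I \<union> J. X (ed i) \<omega>)" for \<omega>
    using IJ by (simp add: prod.union_disjoint)
  have "card (I \<union> J) = 2 * k" using IJ k by (simp add: card_Un_disjoint)
  then have 1: "\<bar>expectation (\<lambda>\<omega>. \<Prod>i\<in>I \<union> J. X (ed i) \<omega>)\<bar> \<le> 2 * real k * mom (2 * k)"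
    using abs_expectation_prod_X_le[of "I \<union> J" ed] IJ ne by auto
  have "\<bar>expectation (\<lambda>\<omega>. \<Prod>i\<in>I. X (ed i) \<omega>) * expectation (\<lambda>\<omega>. \<Prod>i\<in>J. X (ed i) \<omega>)\<bar>
      \<le> (real k * mom k) * (real k * mom k)"
    unfolding abs_mult
    using abs_expectation_prod_X_le[of I ed] abs_expectation_prod_X_le[of J ed] IJ ne k
    by (intro mult_mono) (auto intro: order_trans[OF abs_ge_zero])
  then show ?thesis unfolding un using 1 by (simp add: power2_eq_square)
qed

end

section \<open>Variance of weighted sums over closed walks\<close>

lemma (in prob_space) variance_sum:
  fixes x :: "'i \<Rightarrow> 'a \<Rightarrow> real"
  assumes "finite W" "\<And>f. f \<in> W \<Longrightarrow> integrable M (x f)"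
    and "\<And>f g. f \<in> W \<Longrightarrow> g \<in> W \<Longrightarrow> integrable M (\<lambda>\<omega>. x f \<omega> * x g \<omega>)"
  shows "variance (\<lambda>\<omega>. \<Sum>f\<in>W. x f \<omega>) = (\<Sum>f\<in>W. \<Sum>g\<in>W.
    expectation (\<lambda>\<omega>. x f \<omega> * x g \<omega>) - expectation (x f) * expectation (x g))"
proof -
  have "(\<Sum>f\<in>W. x f \<omega>) - expectation (\<lambda>\<omega>. \<Sum>f\<in>W. x f \<omega>) = (\<Sum>f\<in>W. x f \<omega> - expectation (x f))" for \<omega>
    using assms by (simp add: sum_subtractf)
  then have "variance (\<lambda>\<omega>. \<Sum>f\<in>W. x f \<omega>) =
    expectation (\<lambda>\<omega>. \<Sum>f\<in>W. \<Sum>g\<in>W. (x f \<omega> - expectation (x f)) * (x g \<omega> - expectation (x g)))"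
    by (simp add: power2_eq_square sum_product)
  also have "\<dots> = (\<Sum>f\<in>W. \<Sum>g\<in>W.
      expectation (\<lambda>\<omega>. (x f \<omega> - expectation (x f)) * (x g \<omega> - expectation (x g))))"
    using assms by (simp add: algebra_simps)
  also have "\<dots> = (\<Sum>f\<in>W. \<Sum>g\<in>W.
      expectation (\<lambda>\<omega>. x f \<omega> * x g \<omega>) - expectation (x f) * expectation (x g))"
    using assms by (intro sum.cong refl) (simp add: algebra_simps prob_space)
  finally show ?thesis .
qed

text \<open>The variance is a double sum of weighted covariances. Those that can be nonzero are
  counted by \<open>card_linked_closed_walks\<close>, each covariance has a uniform moment bound,
  and the \<open>2 * k\<close> deterministic weights contribute \<open>K ^ (2 * k)\<close>.\<close>

lemma variance_closed_walk_sum_le: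
  fixes X :: "'v \<times> 'v \<Rightarrow> 'a \<Rightarrow> real" and c :: "'v \<times> 'v \<Rightarrow> real" and d K :: real
  assumes "class_indep_family M (V \<times> V) R X mom"
    and V: "finite V" "V \<noteq> {}" and "k > 0"
    and c: "\<And>e. e \<in> V \<times> V \<Longrightarrow> \<bar>c e\<bar> \<le> K"
    and C1: "\<And>p. p \<in> V \<Longrightarrow>
      real (card {(q, r, s). q \<in> V \<and> r \<in> V \<and> s \<in> V \<and> ((p, q), (r, s)) \<in> R}) \<le> d"
    and C2: "\<And>p q r. p \<in> V \<Longrightarrow> q \<in> V \<Longrightarrow> r \<in> V \<Longrightarrow> card {s \<in> V. ((p, q), (r, s)) \<in> R} \<le> B"
  defines "S \<equiv> \<lambda>\<omega>. \<Sum>f\<in>closed_walks k V. \<Prod>l<k. c (f l, f (Suc l)) * X (f l, f (Suc l)) \<omega>"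
  shows "(\<integral>\<omega>. (S \<omega> - integral\<^sup>L M S)\<^sup>2 \<partial>M) \<le>
    K ^ (2 * k) * (2 * real k * mom (2 * k) + (real k * mom k)\<^sup>2) *
      ((real k)\<^sup>2 * real (2 * k * B + 1) ^ (2 * k - 2) * real (card V) ^ k * d)"
proof -
  interpret class_indep_family M "V \<times> V" R X mom by fact
  let ?W = "closed_walks k V"
  let ?C = "2 * real k * mom (2 * k) + (real k * mom k)\<^sup>2"
  \<comment> \<open>Outside \<open>P\<close> one of the two alternatives of
    \<open>covariance_prod_X_eq_0\<close> holds: with \<open>2 * k\<close> edges in total, an
    isolated class is forced as soon as there are more than \<open>k\<close> classes.\<close>
  define P where "P = {(f, g). f \<in> ?W \<and> g \<in> ?W \<and>
      edge_classes R k f \<inter> edge_classes R k g \<noteq> {} \<and>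
      card (edge_classes R k f \<union> edge_classes R k g) \<le> k}"
  define a where "a f = (\<Prod>l<k. c (f l, f (Suc l)))" for f
  define x where "x f \<omega> = (\<Prod>l<k. X (f l, f (Suc l)) \<omega>)" for f \<omega>
  define cov where "cov f g = expectation (\<lambda>\<omega>. x f \<omega> * x g \<omega>) - expectation (x f) * expectation (x g)" for f g
  have finW: "finite ?W" using V(1) by (rule finite_closed_walks)
  have PW: "P \<subseteq> ?W \<times> ?W" by (auto simp: P_def)
  have WV: "(f l, f (Suc l)) \<in> V \<times> V" if "f \<in> ?W" "l < k" for f l
    using that by (auto simp: closed_walks_def PiE_iff)
  have a: "\<bar>a f\<bar> \<le> K ^ k" if "f \<in> ?W" for f
    unfolding a_def abs_prod using prod_mono[of "{..<k}" "\<lambda>l. \<bar>c (f l, f (Suc l))\<bar>" "\<lambda>_. K"] c WV[OF that]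
    by auto
  have K: "K ^ k \<ge> 0" if "f \<in> ?W" for f using a[OF that] by (meson abs_ge_zero order_trans)
  have int: "integrable M (x f)" "integrable M (\<lambda>\<omega>. x f \<omega> * x g \<omega>)"
    and cov0: "(f, g) \<notin> P \<Longrightarrow> cov f g = 0" and cov_le: "\<bar>cov f g\<bar> \<le> ?C"
    if fg: "f \<in> ?W" "g \<in> ?W" for f g
  proof -
    \<comment> \<open>The disjoint sum keeps the edge positions of the two walks apart, so an edge
      used by both walks counts as two factors.\<close>
    define ed where "ed = case_sum (\<lambda>l. (f l, f (Suc l))) (\<lambda>l. (g l, g (Suc l)))"
    define I where "I = (Inl ` {..<k} :: (nat + nat) set)"
    define J where "J = (Inr ` {..<k} :: (nat + nat) set)"
    have IJ: "finite I" "finite J" "ed ` I \<subseteq> V \<times> V" "ed ` J \<subseteq> V \<times> V" "I \<inter> J = {}"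
      using WV[OF fg(1)] WV[OF fg(2)] by (auto simp: I_def J_def ed_def)
    have card: "card I = k" "card J = k" by (simp_all add: I_def J_def card_image)
    have xf: "x f = (\<lambda>\<omega>. \<Prod>i\<in>I. X (ed i) \<omega>)" and xg: "x g = (\<lambda>\<omega>. \<Prod>i\<in>J. X (ed i) \<omega>)"
      by (simp_all add: fun_eq_iff x_def I_def J_def ed_def prod.reindex)
    have cl: "(\<lambda>i. R `` {ed i}) ` I = edge_classes R k f" "(\<lambda>i. R `` {ed i}) ` J = edge_classes R k g"
      by (simp_all add: edge_classes_def I_def J_def ed_def image_image)
    show "integrable M (x f)" unfolding xf by (rule integrable_prod_X) fact+
    have "(\<lambda>\<omega>. x f \<omega> * x g \<omega>) = (\<lambda>\<omega>. \<Prod>i\<in>I \<union> J. X (ed i) \<omega>)"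
      unfolding xf xg using IJ by (simp add: prod.union_disjoint)
    then show "integrable M (\<lambda>\<omega>. x f \<omega> * x g \<omega>)"
      using integrable_prod_X[of "I \<union> J" ed] IJ by (simp add: image_Un)
    show "\<bar>cov f g\<bar> \<le> ?C"
      unfolding cov_def xf xg using abs_covariance_prod_X_le[OF IJ card \<open>k > 0\<close>] by simp
    show "cov f g = 0" if "(f, g) \<notin> P"
      unfolding cov_def xf xg
      using that fg card covariance_prod_X_eq_0[OF IJ] unfolding cl by (force simp: P_def)
  qed
  have S: "S = (\<lambda>\<omega>. \<Sum>f\<in>?W. a f * x f \<omega>)"
    by (simp add: S_def a_def x_def prod.distrib)
  have "(\<integral>\<omega>. (S \<omega> - integral\<^sup>L M S)\<^sup>2 \<partial>M) = (\<Sum>f\<in>?W. \<Sum>g\<in>?W. a f * a g * cov f g)"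
  proof -
    have "integrable M (\<lambda>\<omega>. (a f * x f \<omega>) * (a g * x g \<omega>))" if "f \<in> ?W" "g \<in> ?W" for f g
      using integrable_mult_right[OF int(2)[OF that], of "a f * a g"] by (simp add: mult_ac)
    moreover have "expectation (\<lambda>\<omega>. (a f * x f \<omega>) * (a g * x g \<omega>)) = a f * a g * expectation (\<lambda>\<omega>. x f \<omega> * x g \<omega>)" for f g
      by (subst integral_mult_right_zero[symmetric]) (simp add: mult_ac)
    ultimately show ?thesis
      unfolding S using int finW by (subst variance_sum) (auto simp: cov_def algebra_simps intro!: sum.cong)
  qed
  also have "\<dots> = (\<Sum>(f, g)\<in>?W \<times> ?W. a f * a g * cov f g)" by (rule sum.cartesian_product)
  also have "\<dots> = (\<Sum>(f, g)\<in>P. a f * a g * cov f g)"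
    using finW PW by (intro sum.mono_neutral_right) (auto simp: cov0 simp del: mult_eq_0_iff)
  finally have var: "(\<integral>\<omega>. (S \<omega> - integral\<^sup>L M S)\<^sup>2 \<partial>M) = (\<Sum>(f, g)\<in>P. a f * a g * cov f g)" .
  have le: "a f * a g * cov f g \<le> K ^ (2 * k) * ?C" if fg: "f \<in> ?W" "g \<in> ?W" for f g
  proof -
    have "a f * a g * cov f g \<le> \<bar>a f\<bar> * \<bar>a g\<bar> * \<bar>cov f g\<bar>"
      by (metis abs_ge_self abs_mult)
    also have "\<dots> \<le> K ^ k * K ^ k * ?C"
      using a[OF fg(1)] a[OF fg(2)] cov_le[OF fg] K[OF fg(1)] by (intro mult_mono) auto
    also have "K ^ k * K ^ k = K ^ (2 * k)" by (simp only: mult_2 power_add)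
    finally show ?thesis .
  qed
  have "(\<Sum>(f, g)\<in>P. a f * a g * cov f g) \<le> card P * (K ^ (2 * k) * ?C)"
    using PW by (intro sum_bounded_above) (auto intro: le)
  moreover have "card P * (K ^ (2 * k) * ?C) \<le>
    ((real k)\<^sup>2 * real (2 * k * B + 1) ^ (2 * k - 2) * real (card V) ^ k * d) * (K ^ (2 * k) * ?C)"
  proof (rule mult_right_mono)
    show "real (card P) \<le> (real k)\<^sup>2 * real (2 * k * B + 1) ^ (2 * k - 2) * real (card V) ^ k * d"
      unfolding P_def using V(1) equiv_R \<open>k > 0\<close> C1 C2 by (rule card_linked_closed_walks)
    \<comment> \<open>No sign of \<open>mom\<close> is assumed; that the constant is non-negative is
      read off from the covariance bound at a constant walk.\<close>
    obtain v where "v \<in> V" using V by auto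
    then have v: "(\<lambda>i\<in>{..k}. v) \<in> ?W" by (auto simp: closed_walks_def)
    have "?C \<ge> 0" using cov_le[OF v v] by (meson abs_ge_zero order_trans)
    then show "K ^ (2 * k) * ?C \<ge> 0" by (intro mult_nonneg_nonneg) auto
  qed
  ultimately show ?thesis unfolding var by (simp only: mult_ac)
qed

section \<open>The normalised trace and its limit\<close>

lemma Y_stat_closed_walks:
  "Y_stat \<alpha> X k N \<omega> = (\<Sum>f\<in>closed_walks k {1..N}.
    \<Prod>l<k. \<alpha> (\<bar>real (f l) - real (f (Suc l))\<bar> / real N) * X N (f l) (f (Suc l)) \<omega>)
    / (sqrt (real N) ^ k * real N)"
  using mat_trace_pow_closed_walks[of N "\<lambda>p q. \<alpha> (\<bar>real p - real q\<bar> / real N) * X N p q \<omega> / sqrt (real N)" k]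
  by (simp add: Y_stat_def band_matrix_def prod_dividef sum_divide_distrib)

theorem mainTheorem15:
  fixes M :: "'a measure"
    and \<alpha> :: "real \<Rightarrow> real"
    and X :: "nat \<Rightarrow> nat \<Rightarrow> nat \<Rightarrow> 'a \<Rightarrow> real"
    and R :: "nat \<Rightarrow> ((nat \<times> nat) \<times> (nat \<times> nat)) set"
  assumes P: "prob_space M"
    and alpha_bdd: "bounded (\<alpha> ` {0..1})"
    and alpha_riemann: "riemann_integrable_on \<alpha> 0 1"
    and X_meas: "\<And>N i j. i \<in> {1..N} \<Longrightarrow> j \<in> {1..N} \<Longrightarrow> X N i j \<in> borel_measurable M"
    and X_sym: "\<And>N i j \<omega>. i \<in> {1..N} \<Longrightarrow> j \<in> {1..N} \<Longrightarrow> X N i j \<omega> = X N j i \<omega>"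
    and X_mean: "\<And>N i j. i \<in> {1..N} \<Longrightarrow> j \<in> {1..N} \<Longrightarrow> integral\<^sup>L M (X N i j) = 0"
    and X_var: "\<And>N i j. i \<in> {1..N} \<Longrightarrow> j \<in> {1..N} \<Longrightarrow> integral\<^sup>L M (\<lambda>\<omega>. (X N i j \<omega>)^2) = 1"
    and X_mom: "\<exists>Rk :: nat \<Rightarrow> real. \<forall>k\<ge>1. \<forall>N. \<forall>i\<in>{1..N}. \<forall>j\<in>{1..N}.
                  integrable M (\<lambda>\<omega>. \<bar>X N i j \<omega>\<bar> ^ k) \<and> integral\<^sup>L M (\<lambda>\<omega>. \<bar>X N i j \<omega>\<bar> ^ k) \<le> Rk k"
    and R_equiv: "\<And>N. equiv ({1..N} \<times> {1..N}) (R N)"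
    and R_swap: "\<And>N p q. p \<in> {1..N} \<Longrightarrow> q \<in> {1..N} \<Longrightarrow> ((p, q), (q, p)) \<in> R N"
    and C1: "\<forall>\<epsilon>>0. \<forall>\<^sub>F N in sequentially. \<forall>p\<in>{1..N}.
               real (card {(q, r, s). q \<in> {1..N} \<and> r \<in> {1..N} \<and> s \<in> {1..N} \<and> ((p, q), (r, s)) \<in> R N})
                 \<le> \<epsilon> * (real N)^2"
    and C2: "\<exists>B::nat. \<forall>N. \<forall>p\<in>{1..N}. \<forall>q\<in>{1..N}. \<forall>r\<in>{1..N}.
               card {s \<in> {1..N}. ((p, q), (r, s)) \<in> R N} \<le> B"
    and C3: "(\<lambda>N. real (card {(p, q, r). p \<in> {1..N} \<and> q \<in> {1..N} \<and> r \<in> {1..N}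
                 \<and> ((p, q), (q, r)) \<in> R N \<and> r \<noteq> p}) / (real N)^2) \<longlonglongrightarrow> 0"
    and indep: "\<And>N. prob_space.indep_vars M (\<lambda>C. PiM C (\<lambda>_. borel))
                  (\<lambda>C \<omega>. \<lambda>pq\<in>C. X N (fst pq) (snd pq) \<omega>) (({1..N} \<times> {1..N}) // R N)"
  shows "\<forall>k::nat. (\<lambda>N. integral\<^sup>L M (\<lambda>\<omega>. (Y_stat \<alpha> X k N \<omega> - integral\<^sup>L M (Y_stat \<alpha> X k N))^2))
           \<longlonglongrightarrow> 0"
proof (intro allI)
  fix k :: nat
  interpret prob_space M by (rule P)
  show "(\<lambda>N. \<integral>\<omega>. (Y_stat \<alpha> X k N \<omega> - integral\<^sup>L M (Y_stat \<alpha> X k N))\<^sup>2 \<partial>M) \<longlonglongrightarrow> 0"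
  proof (cases "k = 0")
    case True
    \<comment> \<open>The zeroth power is the identity matrix, so the statistic is deterministic;
      the walk bounds start at \<open>k = 1\<close>.\<close>
    then have "Y_stat \<alpha> X k N = (\<lambda>_. mat_trace (1\<^sub>m N) / real N)" for N
      by (simp add: Y_stat_def band_matrix_def fun_eq_iff)
    then show ?thesis by (simp add: prob_space)
  next
    case False
    then have "k > 0" by simp
    obtain mom where mom: "\<And>n N i j. n \<ge> 1 \<Longrightarrow> i \<in> {1..N} \<Longrightarrow> j \<in> {1..N} \<Longrightarrow>
        integrable M (\<lambda>\<omega>. \<bar>X N i j \<omega>\<bar> ^ n) \<and> integral\<^sup>L M (\<lambda>\<omega>. \<bar>X N i j \<omega>\<bar> ^ n) \<le> mom n"
      using X_mom by blast
    obtain K where K: "\<And>t. t \<in> {0..1} \<Longrightarrow> \<bar>\<alpha> t\<bar> \<le> K"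
      using alpha_bdd unfolding bounded_iff real_norm_def by blast
    obtain B where B: "\<And>N p q r. p \<in> {1..N} \<Longrightarrow> q \<in> {1..N} \<Longrightarrow> r \<in> {1..N} \<Longrightarrow>
        card {s \<in> {1..N}. ((p, q), (r, s)) \<in> R N} \<le> B"
      using C2 by blast
    \<comment> \<open>\<open>L\<close> gathers all factors that depend on neither \<open>N\<close>
      nor the level in (C1).\<close>
    define L where "L = K ^ (2 * k) * (2 * real k * mom (2 * k) + (real k * mom k)\<^sup>2) *
      ((real k)\<^sup>2 * real (2 * k * B + 1) ^ (2 * k - 2))"
    \<comment> \<open>With \<open>d\<close> equal to \<epsilon> times \<open>N\<close> squared, the
      variance of the unnormalised sum has order \<epsilon> times \<open>N ^ (k + 2)\<close>. The
      square of the normalisation is exactly this power of \<open>N\<close>, so only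
      \<open>L\<close> times \<epsilon> remains.\<close>
    have bound: "(\<integral>\<omega>. (Y_stat \<alpha> X k N \<omega> - integral\<^sup>L M (Y_stat \<alpha> X k N))\<^sup>2 \<partial>M) \<le> L * \<epsilon>"
      if "N > 0" and C1N: "\<forall>p\<in>{1..N}. real (card {(q, r, s). q \<in> {1..N} \<and> r \<in> {1..N} \<and> s \<in> {1..N} \<and>
        ((p, q), (r, s)) \<in> R N}) \<le> \<epsilon> * (real N)\<^sup>2" for N \<epsilon>
    proof -
      define c where "c = (\<lambda>e. \<alpha> (\<bar>real (fst e) - real (snd e)\<bar> / real N))"
      define S where "S = (\<lambda>\<omega>. \<Sum>f\<in>closed_walks k {1..N}.
        \<Prod>l<k. c (f l, f (Suc l)) * X N (fst (f l, f (Suc l))) (snd (f l, f (Suc l))) \<omega>)"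
      have fam: "class_indep_family M ({1..N} \<times> {1..N}) (R N) (\<lambda>e. X N (fst e) (snd e)) mom"
        by unfold_locales (use R_equiv X_meas X_mean mom indep in auto)
      have c: "\<bar>c e\<bar> \<le> K" if "e \<in> {1..N} \<times> {1..N}" for e
        \<comment> \<open>For vertices in \<open>{1..N}\<close> the argument of \<alpha> lies in
          \<open>{0..1}\<close>, where \<open>K\<close> bounds it.\<close>
        unfolding c_def using that \<open>N > 0\<close> by (intro K) (auto simp: divide_le_eq)
      have "(\<integral>\<omega>. (S \<omega> - integral\<^sup>L M S)\<^sup>2 \<partial>M) \<le>
        K ^ (2 * k) * (2 * real k * mom (2 * k) + (real k * mom k)\<^sup>2) *
          ((real k)\<^sup>2 * real (2 * k * B + 1) ^ (2 * k - 2) * real (card {1..N}) ^ k * (\<epsilon> * (real N)\<^sup>2))"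
        unfolding S_def using \<open>N > 0\<close> C1N
        by (intro variance_closed_walk_sum_le[OF fam _ _ \<open>k > 0\<close> c _ B]) auto
      also have "\<dots> = L * \<epsilon> * (real N ^ k * (real N)\<^sup>2)" by (simp add: L_def)
      finally have S: "(\<integral>\<omega>. (S \<omega> - integral\<^sup>L M S)\<^sup>2 \<partial>M) \<le> L * \<epsilon> * (real N ^ k * (real N)\<^sup>2)" .
      have Y: "Y_stat \<alpha> X k N = (\<lambda>\<omega>. S \<omega> / (sqrt (real N) ^ k * real N))"
        by (simp add: Y_stat_closed_walks S_def c_def fun_eq_iff)
      have sq: "(sqrt (real N) ^ k * real N)\<^sup>2 = real N ^ k * (real N)\<^sup>2"
        by (simp add: power_mult_distrib flip: power_mult) (simp add: mult.commute[of k] power_mult)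
      have "(\<integral>\<omega>. (Y_stat \<alpha> X k N \<omega> - integral\<^sup>L M (Y_stat \<alpha> X k N))\<^sup>2 \<partial>M) =
        (\<integral>\<omega>. (S \<omega> - integral\<^sup>L M S)\<^sup>2 / (real N ^ k * (real N)\<^sup>2) \<partial>M)"
        unfolding Y by (simp add: power_divide sq flip: diff_divide_distrib)
      also have "\<dots> = (\<integral>\<omega>. (S \<omega> - integral\<^sup>L M S)\<^sup>2 \<partial>M) / (real N ^ k * (real N)\<^sup>2)" by simp
      also have "\<dots> \<le> L * \<epsilon>" using S \<open>N > 0\<close> by (simp add: divide_le_eq)
      finally show ?thesis .
    qed
    show ?thesis
    proof (rule LIMSEQ_I, goal_cases)
      case (1 e)
      \<comment> \<open>The added 1 keeps the denominator positive and makes the final inequality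
        strict.\<close>
      define \<epsilon> where "\<epsilon> = e / (\<bar>L\<bar> + 1)"
      have "\<epsilon> > 0" using 1 by (simp add: \<epsilon>_def)
      have "L * \<epsilon> \<le> \<bar>L\<bar> * \<epsilon>" using \<open>\<epsilon> > 0\<close> by (intro mult_right_mono) auto
      also have "\<dots> < e" using 1 by (simp add: \<epsilon>_def field_simps)
      finally have "L * \<epsilon> < e" .
      have "\<forall>\<^sub>F N in sequentially. norm ((\<integral>\<omega>. (Y_stat \<alpha> X k N \<omega> - integral\<^sup>L M (Y_stat \<alpha> X k N))\<^sup>2 \<partial>M) - 0) < e"
        using C1[rule_format, OF \<open>\<epsilon> > 0\<close>] eventually_gt_at_top[of 0]
      proof eventually_elim
        case (elim N)
        then show ?case using bound[OF elim(2), of \<epsilon>] \<open>L * \<epsilon> < e\<close> by simp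
      qed
      then show ?case by (simp add: eventually_sequentially)
    qed
  qed
qed

end
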